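(* Let $x,y,z$ be positive integers with $x\le z$ and $|y-z|=1$, and let $(a(n))_{n\ge1}$ be the $(0,x,y,z)$-hiccup sequence. Then $(a(n))$ is a Beatty sequence: there exist real numbers $\alpha,\beta$ such that either $a(n)=\lfloor \alpha n+\beta\rfloor$ for all $n\ge1$, or $a(n)=\lceil \alpha n+\beta\rceil$ for all $n\ge1$.
   Context: For $x\in\mathbb{Z}_{\ge0}$ and $y,z\in\mathbb{Z}_{\ge1}$ with $y\ne z$, the $(0,x,y,z)$-hiccup sequence is the integer sequence $(a(n))_{n\ge1}$ defined by $a(1)=x$ and, for $n\ge 2$, $a(n)=a(n-1)+y$ if $n\in\{a(k):1\le k<n\}$, and $a(n)=a(n-1)+z$ otherwise.
   Formalization: The single triple (x,y,z) = (1,1,2) is excluded: it satisfies all the hypotheses but gives the sequence 1, 3, 4, 5, 6, …, which is not a Beatty sequence, so the claim as stated fails there. *)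

theory Defs
  imports Complex_Main
begin

(* The (0,x,y,z)-hiccup sequence. It is indexed from 1; the value at index 0 is a dummy,
   and the interval {1..<n} keeps it out of the set of earlier values. *)
function hiccup :: "int \<Rightarrow> int \<Rightarrow> int \<Rightarrow> nat \<Rightarrow> int" where
  "hiccup x y z n =
     (if n \<le> 1 then x
      else hiccup x y z (n - 1) + (if int n \<in> hiccup x y z ` {1..<n} then y else z))"
  by auto
termination by (relation "measure (\<lambda>(x, y, z, n). n)") auto

declare hiccup.simps [simp del]

definition is_beatty :: "(nat \<Rightarrow> int) \<Rightarrow> bool" where
  "is_beatty a \<longleftrightarrow>
     (\<exists>\<alpha> \<beta> :: real. (\<forall>n\<ge>1. a n = \<lfloor>\<alpha> * real n + \<beta>\<rfloor>) \<or> (\<forall>n\<ge>1. a n = \<lceil>\<alpha> * real n + \<beta>\<rceil>))"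

(* The triple (x,y,z) = (1,1,2) satisfies 0 < x <= z and |y - z| = 1, but gives the sequence
   1, 3, 4, 5, 6, ..., which is not a Beatty sequence. *)

lemma hiccup_1_1_2:
  shows "hiccup 1 1 2 (Suc 0) = 1"
    and "n \<ge> 2 \<Longrightarrow> hiccup 1 1 2 n = int n + 1"
proof -
  show first: "hiccup 1 1 2 (Suc 0) = 1"
    by (subst hiccup.simps) simp
  show "hiccup 1 1 2 n = int n + 1" if "n \<ge> 2"
    using that
  proof (induction n rule: nat_induct_at_least)
    case base
    have "{1..<2} = {Suc 0}" by auto
    then show ?case
      by (subst hiccup.simps) (simp add: first)
  next
    case (Suc n)
    have "hiccup 1 1 2 n = int (Suc n)" using Suc.IH by simp
    then have "int (Suc n) \<in> hiccup 1 1 2 ` {1..<Suc n}"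
      using Suc.hyps by (intro image_eqI[of _ _ n]) auto
    then show ?case
      using Suc by (subst hiccup.simps) simp
  qed
qed

lemma not_is_beatty_hiccup_1_1_2: "\<not> is_beatty (hiccup 1 1 2)"
proof
  assume "is_beatty (hiccup 1 1 2)"
  then obtain \<alpha> \<beta> :: real where
    "(\<forall>n\<ge>1. hiccup 1 1 2 n = \<lfloor>\<alpha> * real n + \<beta>\<rfloor>) \<or> (\<forall>n\<ge>1. hiccup 1 1 2 n = \<lceil>\<alpha> * real n + \<beta>\<rceil>)"
    unfolding is_beatty_def by blast
  then have "\<alpha> > 1 \<and> (\<forall>n\<ge>2. \<alpha> * real n + \<beta> \<le> real n + 2)"
  proof
    assume fl: "\<forall>n\<ge>1. hiccup 1 1 2 n = \<lfloor>\<alpha> * real n + \<beta>\<rfloor>"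
    have "\<lfloor>\<alpha> + \<beta>\<rfloor> = 1" using fl[rule_format, of 1] by (simp add: hiccup_1_1_2)
    moreover have ge2: "\<lfloor>\<alpha> * real n + \<beta>\<rfloor> = int n + 1" if "n \<ge> 2" for n
      using fl[rule_format, of n] that by (simp add: hiccup_1_1_2)
    moreover have "\<lfloor>\<alpha> * 2 + \<beta>\<rfloor> = 3" using ge2[of 2] by simp
    ultimately have "\<alpha> > 1" by linarith
    moreover have "\<alpha> * real n + \<beta> \<le> real n + 2" if "n \<ge> 2" for n
      using ge2[OF that] by linarith
    ultimately show ?thesis by blast
  next
    assume cl: "\<forall>n\<ge>1. hiccup 1 1 2 n = \<lceil>\<alpha> * real n + \<beta>\<rceil>"
    have "\<lceil>\<alpha> + \<beta>\<rceil> = 1" using cl[rule_format, of 1] by (simp add: hiccup_1_1_2)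
    moreover have ge2: "\<lceil>\<alpha> * real n + \<beta>\<rceil> = int n + 1" if "n \<ge> 2" for n
      using cl[rule_format, of n] that by (simp add: hiccup_1_1_2)
    moreover have "\<lceil>\<alpha> * 2 + \<beta>\<rceil> = 3" using ge2[of 2] by simp
    ultimately have "\<alpha> > 1" by linarith
    moreover have "\<alpha> * real n + \<beta> \<le> real n + 2" if "n \<ge> 2" for n
      using ge2[OF that] by linarith
    ultimately show ?thesis by blast
  qed
  then have gt: "\<alpha> - 1 > 0" and le: "\<And>n. n \<ge> 2 \<Longrightarrow> \<alpha> * real n + \<beta> \<le> real n + 2" by auto
  obtain m :: nat where m: "2 - \<beta> < real m * (\<alpha> - 1)"
    using reals_Archimedean3[OF gt] by blast
  have "real m * (\<alpha> - 1) \<le> real (m + 2) * (\<alpha> - 1)"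
    using gt by (intro mult_right_mono) auto
  with m have "2 - \<beta> < real (m + 2) * (\<alpha> - 1)" by linarith
  with le[of "m + 2"] show False by (simp add: algebra_simps)
qed

end

theory Submission
  imports Defs
begin

text \<open>
  Let \<open>s = y - z\<close> and let \<open>\<alpha>\<close> be the larger root of \<open>t\<^sup>2 = z t + s\<close>. For \<open>b n = \<lfloor>\<alpha> n + \<beta>\<rfloor>\<close>
  the indicator of \<open>n \<in> range b\<close> is the increment of \<open>\<lceil>(m - \<beta>) / \<alpha>\<rceil>\<close> from \<open>m = n\<close> to \<open>m = n + 1\<close>.
  Since \<open>1 / \<alpha> = s (\<alpha> - z)\<close>, this ceiling at \<open>m = n + 1\<close> is again \<open>s (\<alpha> n - z n)\<close> plus a constant,
  rounded; a suitable \<open>\<beta>\<close> turns the rounded term into \<open>s (b n - z n)\<close> up to an integer constant, which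
  is the hiccup recursion. For \<open>s = 1\<close> a ceiling has to be exchanged for a floor, which uses that \<open>\<alpha>\<close>
  is irrational. For \<open>s = -1\<close> and \<open>x = 1\<close> the sequence differs from the one for \<open>x = 2\<close> only at
  \<open>n = 1\<close>, where \<open>\<alpha> n + \<beta>\<close> is an integer, so that passing to ceilings repairs it.
\<close>

section \<open>The hiccup recursion and its unique solution\<close>

lemma hiccup_1: "hiccup x y z (Suc 0) = x"
  by (subst hiccup.simps) simp

lemma hiccup_step:
  "n \<ge> 2 \<Longrightarrow> hiccup x y z n =
     hiccup x y z (n - 1) + (if int n \<in> hiccup x y z ` {1..<n} then y else z)"
  by (subst hiccup.simps) simp

text \<open>The step at \<open>n\<close> consults only values at smaller indices, so strong
  induction applies. A closed form is thus verified by checking the recursion on it.\<close>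

lemma hiccup_unique:
  assumes "b 1 = x"
    and step: "\<And>n. n \<ge> 2 \<Longrightarrow> b n = b (n - 1) + (if int n \<in> b ` {1..<n} then y else z)"
    and "n \<ge> 1"
  shows "hiccup x y z n = b n"
  using \<open>n \<ge> 1\<close>
proof (induction n rule: less_induct)
  case (less n)
  show ?case
  proof (cases "n = 1")
    case True
    then show ?thesis using assms(1) by (simp add: hiccup_1)
  next
    case False
    with less.prems have n: "n \<ge> 2" by simp
    have "hiccup x y z ` {1..<n} = b ` {1..<n}"
      by (rule image_cong) (auto simp: less.IH)
    moreover have "hiccup x y z (n - 1) = b (n - 1)"
      using n by (intro less.IH) auto
    ultimately show ?thesis
      by (simp only: hiccup_step[OF n] step[OF n])
  qed
qed

section \<open>Counting Beatty values with ceilings\<close>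

text \<open>The ceiling of \<open>(m - \<beta>) / \<alpha>\<close> is the least integer
  \<open>k\<close> with \<open>m \<le> \<alpha> * k + \<beta>\<close>. Hence the difference counts
  the \<open>k\<close> whose value has floor \<open>m\<close>; since \<open>\<alpha> \<ge> 1\<close>
  there is at most one.\<close>

lemma beatty_indicator:
  fixes \<alpha> \<beta> :: real and m :: int
  assumes "\<alpha> \<ge> 1"
  shows "\<lceil>(m + 1 - \<beta>) / \<alpha>\<rceil> - \<lceil>(m - \<beta>) / \<alpha>\<rceil> =
    (if \<exists>k::int. \<lfloor>\<alpha> * k + \<beta>\<rfloor> = m then 1 else 0)"
proof -
  define N where "N = \<lceil>(m - \<beta>) / \<alpha>\<rceil>"
  define N' where "N' = \<lceil>(m + 1 - \<beta>) / \<alpha>\<rceil>"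
  have pos: "\<alpha> > 0" using assms by simp
  have "N - 1 < (m - \<beta>) / \<alpha>" "(m - \<beta>) / \<alpha> \<le> N"
    and "N' - 1 < (m + 1 - \<beta>) / \<alpha>" "(m + 1 - \<beta>) / \<alpha> \<le> N'"
    unfolding N_def N'_def by linarith+
  then have N: "\<alpha> * (N - 1) + \<beta> < m" "m \<le> \<alpha> * N + \<beta>"
    and N': "\<alpha> * (N' - 1) + \<beta> < m + 1" "m + 1 \<le> \<alpha> * N' + \<beta>"
    using pos by (simp_all add: field_simps)
  have "N \<le> N'"
    unfolding N_def N'_def using pos by (intro ceiling_mono divide_right_mono) auto
  have "(m + 1 - \<beta>) / \<alpha> \<le> (m - \<beta>) / \<alpha> + 1"
    using assms by (simp add: field_simps)
  then have "N' \<le> N + 1" unfolding N_def N'_def by linarith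
  show ?thesis
  proof (cases "\<exists>k::int. \<lfloor>\<alpha> * k + \<beta>\<rfloor> = m")
    case True
    then obtain k :: int where "\<lfloor>\<alpha> * k + \<beta>\<rfloor> = m" ..
    then have k: "m \<le> \<alpha> * k + \<beta>" "\<alpha> * k + \<beta> < m + 1" by linarith+
    have "\<alpha> * (N - 1) < \<alpha> * k" "\<alpha> * k < \<alpha> * N'" using N N' k by linarith+
    then have "real_of_int (N - 1) < k" "real_of_int k < N'"
      using pos by (simp_all add: mult_less_cancel_left)
    then have "N - 1 < k" "k < N'" by (simp_all only: of_int_less_iff)
    then have "N + 1 \<le> N'" by linarith
    with \<open>N' \<le> N + 1\<close> True show ?thesis by (simp add: N_def N'_def)
  next
    case False
    have "N' \<noteq> N + 1"
    proof
      assume "N' = N + 1"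
      with N N' have "\<lfloor>\<alpha> * N + \<beta>\<rfloor> = m" by (intro floor_unique) auto
      with False show False by blast
    qed
    with \<open>N \<le> N'\<close> \<open>N' \<le> N + 1\<close> False show ?thesis by (simp add: N_def N'_def)
  qed
qed

text \<open>Differencing \<open>formula\<close> gives \<open>z\<close> plus \<open>s\<close> times
  the indicator of \<open>beatty_indicator\<close>. That indicator ranges over all integers
  \<open>k\<close>, the recursion only over \<open>{1..<n}\<close>; the bounds on
  \<open>\<alpha>\<close> and \<open>\<beta>\<close> reconcile the two.\<close>

lemma hiccup_eq_floor:
  fixes \<alpha> \<beta> :: real and x z s c :: int
  assumes "\<alpha> > 2" and "\<beta> < 2" and "x \<ge> 1" and first: "\<lfloor>\<alpha> + \<beta>\<rfloor> = x"
    and formula: "\<And>n::nat. n \<ge> 1 \<Longrightarrow>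
      \<lfloor>\<alpha> * n + \<beta>\<rfloor> = c + z * int n + s * \<lceil>(real n + 1 - \<beta>) / \<alpha>\<rceil>"
    and "n \<ge> 1"
  shows "hiccup x (z + s) z n = \<lfloor>\<alpha> * real n + \<beta>\<rfloor>"
proof (rule hiccup_unique[OF _ _ \<open>n \<ge> 1\<close>])
  show "\<lfloor>\<alpha> * real 1 + \<beta>\<rfloor> = x" using first by simp
next
  fix n :: nat
  assume n: "n \<ge> 2"
  let ?b = "\<lambda>n::nat. \<lfloor>\<alpha> * real n + \<beta>\<rfloor>"
  have "(\<exists>k::int. \<lfloor>\<alpha> * k + \<beta>\<rfloor> = int n) \<longleftrightarrow> int n \<in> ?b ` {1..<n}"
  proof
    assume "\<exists>k::int. \<lfloor>\<alpha> * k + \<beta>\<rfloor> = int n"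
    then obtain k :: int where k: "\<lfloor>\<alpha> * k + \<beta>\<rfloor> = int n" ..
    then have up: "real n \<le> \<alpha> * k + \<beta>" and low: "\<alpha> * k + \<beta> < real n + 1" by linarith+
    have "k \<ge> 1"
    proof (rule ccontr)
      assume "\<not> k \<ge> 1"
      then have "\<alpha> * k \<le> 0" using \<open>\<alpha> > 2\<close> by (intro mult_nonneg_nonpos) auto
      with up \<open>\<beta> < 2\<close> n show False by linarith
    qed
    have "k < int n"
    proof (cases "k = 1")
      case False
      \<comment> \<open>From \<open>k = 1\<close> on, where the value is at least 1, each index adds
        more than 2. So \<open>2 * k - 1 < n + 1\<close>, which gives \<open>k < n\<close> once
        \<open>k \<ge> 2\<close>.\<close>
      have "2 * (real_of_int k - 1) \<le> \<alpha> * (real_of_int k - 1)"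
        using \<open>\<alpha> > 2\<close> \<open>k \<ge> 1\<close> by (intro mult_right_mono) auto
      moreover have "\<alpha> + \<beta> \<ge> 1" using first \<open>x \<ge> 1\<close> by linarith
      ultimately have "2 * real_of_int k - 1 < real n + 1"
        using low by (simp add: algebra_simps)
      with False \<open>k \<ge> 1\<close> show ?thesis by linarith
    qed (use n in simp)
    with \<open>k \<ge> 1\<close> have "nat k \<in> {1..<n}" by auto
    moreover have "int n = ?b (nat k)" using k \<open>k \<ge> 1\<close> by simp
    ultimately show "int n \<in> ?b ` {1..<n}" by blast
  next
    assume "int n \<in> ?b ` {1..<n}"
    then obtain k :: nat where "int n = ?b k" by blast
    then show "\<exists>k::int. \<lfloor>\<alpha> * k + \<beta>\<rfloor> = int n" by (intro exI[of _ "int k"]) simp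
  qed
  with beatty_indicator[of \<alpha> "int n" \<beta>] \<open>\<alpha> > 2\<close>
  have *: "\<lceil>(real n + 1 - \<beta>) / \<alpha>\<rceil> = \<lceil>(real n - \<beta>) / \<alpha>\<rceil> + (if int n \<in> ?b ` {1..<n} then 1 else 0)"
    by simp
  have "?b (n - 1) = c + z * (int n - 1) + s * \<lceil>(real n - \<beta>) / \<alpha>\<rceil>"
    using formula[of "n - 1"] n by (simp add: of_nat_diff)
  then show "?b n = ?b (n - 1) + (if int n \<in> ?b ` {1..<n} then z + s else z)"
    using formula[of n] n unfolding * by (simp add: algebra_simps)
qed

text \<open>If \<open>q \<alpha>\<close> is an integer then so is \<open>q' \<alpha>\<close> for the integer \<open>q' = \<bar>q (\<alpha> - z)\<bar> = q / \<alpha> < q\<close>.\<close>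

lemma quadratic_unit_mult_not_int:
  fixes \<alpha> :: real and z s p q :: int
  assumes "\<alpha> > 1" and root: "\<alpha>\<^sup>2 = z * \<alpha> + s" and s: "\<bar>s\<bar> = 1"
    and "q \<noteq> 0" and "q * \<alpha> = p"
  shows False
proof -
  have "\<not> (q > 0 \<and> (\<exists>p::int. real q * \<alpha> = p))" for q :: nat
  proof (induction q rule: less_induct)
    case (less q)
    show ?case
    proof
      assume "q > 0 \<and> (\<exists>p::int. real q * \<alpha> = p)"
      then obtain p :: int where "q > 0" and p: "real q * \<alpha> = p" by blast
      define r where "r = s * (p - z * int q)"
      have s2: "real_of_int s * s = 1"
        using s by (cases "s = 1"; cases "s = -1") auto
      have "real_of_int r = s * (real q * \<alpha> - z * real q)" by (simp add: r_def p)
      then have "r * \<alpha> = s * (real q * \<alpha> - z * real q) * \<alpha>" by simp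
      also have "\<dots> = s * real q * (\<alpha>\<^sup>2 - z * \<alpha>)"
        by (simp add: power2_eq_square algebra_simps)
      also have "\<dots> = q" using root s2 by simp
      finally have r: "r * \<alpha> = q" .
      then have "real_of_int r > 0"
        using \<open>q > 0\<close> \<open>\<alpha> > 1\<close>
        by (metis of_nat_0_less_iff zero_less_mult_pos2 less_trans zero_less_one)
      moreover from this have "real_of_int r < r * \<alpha>" using \<open>\<alpha> > 1\<close> by simp
      ultimately have "nat r < q" "nat r > 0" using r by linarith+
      moreover have "real (nat r) * \<alpha> = int q" using r \<open>nat r > 0\<close> by simp
      ultimately show False using less.IH[of "nat r"] by (metis of_int_of_nat_eq)
    qed
  qed
  from this[of "nat \<bar>q\<bar>"] have "\<nexists>p::int. real_of_int \<bar>q\<bar> * \<alpha> = p"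
    using \<open>q \<noteq> 0\<close> by simp
  moreover have "real_of_int \<bar>q\<bar> * \<alpha> = (if q > 0 then p else - p)"
    using \<open>q * \<alpha> = p\<close> \<open>q \<noteq> 0\<close> by auto
  ultimately show False by blast
qed

section \<open>The case y = z + 1\<close>

lemma hiccup_plus_one:
  fixes \<alpha> :: real and x z :: int
  assumes root: "\<alpha>\<^sup>2 = z * \<alpha> + 1" and \<alpha>: "z < \<alpha>" "\<alpha> < z + 1"
    and "z \<ge> 2" and x: "1 \<le> x" "x \<le> z"
  shows "is_beatty (hiccup x (z + 1) z)"
proof -
  \<comment> \<open>The value 1 of \<open>a\<close> never triggers a hiccup, so \<open>x = 1\<close> behaves like an initial value 0.\<close>
  define x' where "x' = (if x = 1 then 0 else x)"
  \<comment> \<open>This is the solution of the linear equation \<open>fix\<beta>\<close>, with its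
    denominator rationalised by \<open>root\<close>.\<close>
  define \<beta> where "\<beta> = ((x' - z - 1) * \<alpha> + 1 - x' + 2 * z) / z"
  have z: "real_of_int z \<ge> 2" using \<open>z \<ge> 2\<close> by simp
  have z\<beta>: "z * \<beta> = (x' - z - 1) * \<alpha> + 1 - x' + 2 * z"
    using z by (simp add: \<beta>_def)
  have "z * \<beta> = z * (x' - z + (\<alpha> - z) * (1 - \<beta>))"
  proof -
    have "z * (x' - z + (\<alpha> - z) * (1 - \<beta>)) = z * (x' - z + (\<alpha> - z)) - (\<alpha> - z) * (z * \<beta>)"
      by (simp add: algebra_simps)
    also have "\<dots> = z * \<beta> + (x' - z - 1) * (z * \<alpha> + 1 - \<alpha>\<^sup>2)"
      unfolding z\<beta> by (simp add: algebra_simps power2_eq_square)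
    also have "\<dots> = z * \<beta>" by (simp add: root)
    finally show ?thesis by (rule sym)
  qed
  then have fix\<beta>: "\<beta> = x' - z + (\<alpha> - z) * (1 - \<beta>)" using z by simp
  have "1 / \<alpha> = \<alpha> - z"
    using root \<alpha> z by (simp add: field_simps power2_eq_square)
  then have inv: "t / \<alpha> = t * (\<alpha> - z)" for t
    by (metis mult.right_neutral times_divide_eq_right)
  have nonint: "\<alpha> * n + \<beta> \<noteq> m" if "n \<ge> 1" for n :: nat and m :: int
  proof
    assume eq: "\<alpha> * n + \<beta> = m"
    have "(z * int n - z - 1 + x') * \<alpha> = z * (\<alpha> * n + \<beta>) + (x' - 1 - 2 * z)"
      using z\<beta> by (simp add: algebra_simps)
    also have "\<dots> = z * m + x' - 1 - 2 * z" unfolding eq by simp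
    finally have "(z * int n - z - 1 + x') * \<alpha> = (z * m + x' - 1 - 2 * z :: int)" by simp
    then have "z * int n - z - 1 + x' = 0"
      using quadratic_unit_mult_not_int[of \<alpha> z 1 "z * int n - z - 1 + x'" "z * m + x' - 1 - 2 * z"]
        root \<alpha> z by auto
    \<comment> \<open>Here \<open>x' - 1\<close> is -1 or lies between 1 and \<open>z - 1\<close>,
      so it is no multiple of \<open>z\<close>. Keeping \<open>x' = 1\<close> would break this:
      \<open>\<alpha> + \<beta>\<close> would be 2.\<close>
    then have "x' - 1 = z * (1 - int n)" by (simp add: algebra_simps)
    then have "z dvd x' - 1" by simp
    then show False
      using x \<open>z \<ge> 2\<close> zdvd_not_zless[of "x' - 1" z]
      by (cases "x = 1") (auto simp: x'_def)
  qed
  have "hiccup x (z + 1) z n = \<lfloor>\<alpha> * real n + \<beta>\<rfloor>" if "n \<ge> 1" for n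
  proof (rule hiccup_eq_floor[OF _ _ _ _ _ that])
    show "\<alpha> > 2" using \<alpha> z by simp
    have "(x' - z - 1) * \<alpha> + 1 - x' < 0"
    proof (cases "x = 1")
      case True
      have "z * \<alpha> > 0" using \<alpha> z by (intro mult_pos_pos) auto
      moreover have "\<alpha> > 1" using \<alpha> z by simp
      ultimately have "z * \<alpha> + \<alpha> > 1" by linarith
      with True show ?thesis by (simp add: x'_def algebra_simps)
    next
      case False
      then have "real_of_int (x' - z - 1) * \<alpha> \<le> 0" "x' \<ge> 2"
        using x \<alpha> z by (auto simp: x'_def intro!: mult_nonpos_nonneg)
      then show ?thesis by simp
    qed
    then show "\<beta> < 2" using z by (simp add: \<beta>_def field_simps)
    show "x \<ge> 1" by fact
    have eq: "\<alpha> + \<beta> = 2 + (x' - 1) * ((\<alpha> - 1) / z)"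
      using z by (simp add: \<beta>_def field_simps)
    define \<theta> where "\<theta> = (\<alpha> - 1) / z"
    have \<theta>: "0 < \<theta>" "\<theta> < 1" using \<alpha> z by (simp_all add: \<theta>_def field_simps)
    \<comment> \<open>For \<open>x = 1\<close> the sum is \<open>2 - \<theta>\<close>. Otherwise it
      falls short of \<open>x + 1\<close> by \<open>(x - 1) * (1 - \<theta>)\<close>, which is
      positive and, because \<open>x \<le> z\<close>, below 1.\<close>
    show "\<lfloor>\<alpha> + \<beta>\<rfloor> = x"
    proof (cases "x = 1")
      case True
      then show ?thesis unfolding eq \<theta>_def[symmetric] using \<theta>
        by (simp add: x'_def floor_eq_iff)
    next
      case False
      have "z * \<theta> = \<alpha> - 1" using z by (simp add: \<theta>_def)
      then have "z * (1 - \<theta>) < 1" using \<alpha> by (simp add: algebra_simps)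
      moreover have "(x - 1) * (1 - \<theta>) \<le> z * (1 - \<theta>)"
        using x \<theta> by (intro mult_right_mono) auto
      moreover have "(x - 1) * \<theta> < real_of_int (x - 1) * 1"
        using False x \<theta> by (intro mult_strict_left_mono) auto
      ultimately show ?thesis unfolding eq \<theta>_def[symmetric] using False
        by (simp add: x'_def floor_eq_iff algebra_simps)
    qed
  next
    fix n :: nat
    assume "n \<ge> 1"
    have "(real n + 1 - \<beta>) / \<alpha> = \<alpha> * n - z * n + (\<alpha> - z) * (1 - \<beta>)"
      unfolding inv by (simp add: algebra_simps)
    also have "\<dots> = \<alpha> * n + \<beta> - (z * int n + x' - z :: int)"
      using fix\<beta> by simp
    finally have "\<lceil>(real n + 1 - \<beta>) / \<alpha>\<rceil> = \<lceil>\<alpha> * n + \<beta>\<rceil> - (z * int n + x' - z)"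
      by (simp only: ceiling_diff_of_int)
    moreover have "\<lceil>\<alpha> * n + \<beta>\<rceil> = \<lfloor>\<alpha> * n + \<beta>\<rfloor> + 1"
      using nonint[OF \<open>n \<ge> 1\<close>] by (metis ceiling_altdef)
    ultimately show "\<lfloor>\<alpha> * n + \<beta>\<rfloor> = (x' - z - 1) + z * int n + 1 * \<lceil>(real n + 1 - \<beta>) / \<alpha>\<rceil>"
      by simp
  qed
  then show ?thesis unfolding is_beatty_def by blast
qed

section \<open>The case y = z - 1\<close>

text \<open>Now \<open>1 / \<alpha> = z - \<alpha>\<close> has the opposite sign, so the ceiling
  turns directly into a floor of \<open>\<alpha> * n + \<beta>\<close>. For \<open>x = 1\<close> the
  formula would start at 0, so that initial value is treated separately.\<close>

lemma hiccup_minus_one: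
  fixes \<alpha> :: real and x z :: int
  assumes root: "\<alpha>\<^sup>2 = z * \<alpha> - 1" and \<alpha>: "z - 1 < \<alpha>" "\<alpha> < z"
    and "z \<ge> 3" and x: "2 \<le> x" "x \<le> z" and "n \<ge> 1"
  shows "hiccup x (z - 1) z n =
    \<lfloor>\<alpha> * real n + ((x - z) * \<alpha> + 2 * z - 2 - x) / (z - 2)\<rfloor>"
proof -
  define \<beta> where "\<beta> = ((x - z) * \<alpha> + 2 * z - 2 - x) / (z - 2)"
  have z: "real_of_int z \<ge> 3" using \<open>z \<ge> 3\<close> by simp
  have z\<beta>: "(z - 2) * \<beta> = (x - z) * \<alpha> + 2 * z - 2 - x"
    using z by (simp add: \<beta>_def)
  have "(z - 2) * \<beta> = (z - 2) * (x - z + 1 + (\<alpha> - z) * (1 - \<beta>))"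
  proof -
    have "(z - 2) * (x - z + 1 + (\<alpha> - z) * (1 - \<beta>)) =
        (z - 2) * (x - z + 1 + (\<alpha> - z)) - (\<alpha> - z) * ((z - 2) * \<beta>)"
      by (simp add: algebra_simps)
    also have "\<dots> = (z - 2) * \<beta> + (x - z) * (z * \<alpha> - 1 - \<alpha>\<^sup>2)"
      unfolding z\<beta> by (simp add: algebra_simps power2_eq_square)
    also have "\<dots> = (z - 2) * \<beta>" by (simp add: root)
    finally show ?thesis by (rule sym)
  qed
  then have fix\<beta>: "\<beta> = x - z + 1 + (\<alpha> - z) * (1 - \<beta>)" using z by simp
  have "1 / \<alpha> = z - \<alpha>"
    using root \<alpha> z by (simp add: field_simps power2_eq_square)
  then have inv: "t / \<alpha> = t * (z - \<alpha>)" for t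
    by (metis mult.right_neutral times_divide_eq_right)
  have "hiccup x (z + (-1)) z n = \<lfloor>\<alpha> * real n + \<beta>\<rfloor>"
  proof (rule hiccup_eq_floor[OF _ _ _ _ _ \<open>n \<ge> 1\<close>])
    show "\<alpha> > 2" using \<alpha> z by simp
    have "(x - z) * \<alpha> + 2 - x < 0"
    proof (cases "x = 2")
      case True
      then show ?thesis using \<alpha> z by (simp add: mult_neg_pos)
    next
      case False
      then have "real_of_int (x - z) * \<alpha> \<le> 0"
        using x \<alpha> z by (auto intro!: mult_nonpos_nonneg)
      with False x show ?thesis by simp
    qed
    then show "\<beta> < 2" using z by (simp add: \<beta>_def field_simps)
    show "x \<ge> 1" using x by simp
    have eq: "\<alpha> + \<beta> = 2 + (x - 2) * ((\<alpha> - 1) / (z - 2))"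
      using z by (simp add: \<beta>_def field_simps)
    \<comment> \<open>Now \<open>\<theta> \<ge> 1\<close>, and
      \<open>\<alpha> + \<beta> = x + (x - 2) * (\<theta> - 1)\<close>; the last product is shown to
      lie in [0, 1).\<close>
    define \<theta> where "\<theta> = (\<alpha> - 1) / (z - 2)"
    have "(z - 2) * \<theta> = \<alpha> - 1" using z by (simp add: \<theta>_def)
    then have "(z - 2) * (\<theta> - 1) < 1" using \<alpha> by (simp add: algebra_simps)
    moreover have "1 \<le> \<theta>" using \<alpha> z by (simp add: \<theta>_def field_simps)
    moreover have "(x - 2) * (\<theta> - 1) \<le> (z - 2) * (\<theta> - 1)"
      using x \<open>1 \<le> \<theta>\<close> by (intro mult_right_mono) auto
    moreover have "0 \<le> (x - 2) * (\<theta> - 1)"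
      using x \<open>1 \<le> \<theta>\<close> by (intro mult_nonneg_nonneg) auto
    ultimately show "\<lfloor>\<alpha> + \<beta>\<rfloor> = x" unfolding eq \<theta>_def[symmetric]
      by (simp add: floor_eq_iff algebra_simps)
  next
    fix n :: nat
    have "(real n + 1 - \<beta>) / \<alpha> = - (\<alpha> * n - z * n + (\<alpha> - z) * (1 - \<beta>))"
      unfolding inv by (simp add: algebra_simps)
    also have "\<dots> = - (\<alpha> * n + \<beta> - (z * int n + x - z + 1 :: int))"
      using fix\<beta> by simp
    finally have "\<lceil>(real n + 1 - \<beta>) / \<alpha>\<rceil> = - (\<lfloor>\<alpha> * n + \<beta>\<rfloor> - (z * int n + x - z + 1))"
      by (simp only: ceiling_minus floor_diff_of_int)
    then show "\<lfloor>\<alpha> * n + \<beta>\<rfloor> = (x - z + 1) + z * int n + (-1) * \<lceil>(real n + 1 - \<beta>) / \<alpha>\<rceil>"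
      by simp
  qed
  then show ?thesis by (simp add: \<beta>_def)
qed

text \<open>At \<open>n = 2\<close> the start 2 triggers the hiccup and the start 1 does not, so
  both sequences reach \<open>z + 1\<close>. Afterwards the value sets differ only in 1 and 2, which
  are never tested again.\<close>

lemma hiccup_1_eq_hiccup_2:
  assumes "n \<ge> 1"
  shows "hiccup 1 (z - 1) z n = ((hiccup 2 (z - 1) z)(1 := 1)) n"
proof (rule hiccup_unique[OF _ _ assms])
  let ?a = "hiccup 2 (z - 1) z"
  fix n :: nat
  assume "n \<ge> 2"
  show "(?a(1 := 1)) n =
    (?a(1 := 1)) (n - 1) + (if int n \<in> (?a(1 := 1)) ` {1..<n} then z - 1 else z)"
  proof (cases "n = 2")
    case True
    have "{1..<2} = {Suc 0}" by auto
    then show ?thesis using True hiccup_step[of 2 2 "z - 1" z] by (simp add: hiccup_1)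
  next
    case False
    with \<open>n \<ge> 2\<close> have split: "{1..<n} = insert 1 {2..<n}" and "n \<ge> 3" by auto
    have "(?a(1 := 1)) ` {2..<n} = ?a ` {2..<n}" by (rule image_cong) auto
    then have "(?a(1 := 1)) ` {1..<n} = insert 1 (?a ` {2..<n})"
      unfolding split image_insert by simp
    moreover have "?a ` {1..<n} = insert 2 (?a ` {2..<n})"
      unfolding split image_insert by (simp add: hiccup_1)
    ultimately have "int n \<in> (?a(1 := 1)) ` {1..<n} \<longleftrightarrow> int n \<in> ?a ` {1..<n}"
      using \<open>n \<ge> 3\<close> by simp
    with \<open>n \<ge> 3\<close> show ?thesis using hiccup_step[of n 2 "z - 1" z] by auto
  qed
qed simp

section \<open>Small parameters and the case distinction\<close>

lemma is_beatty_affine: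
  assumes "\<And>n. n \<ge> 1 \<Longrightarrow> a n = int n + c"
  shows "is_beatty a"
proof -
  have "a n = \<lfloor>1 * real n + real_of_int c\<rfloor>" if "n \<ge> 1" for n
    using assms[OF that] by simp
  then show ?thesis unfolding is_beatty_def by blast
qed

theorem theorem13:
  fixes x y z :: int
  assumes "x > 0" and "y > 0" and "z > 0"
    and "x \<le> z" and "\<bar>y - z\<bar> = 1"
    and "(x, y, z) \<noteq> (1, 1, 2)"
  shows "is_beatty (hiccup x y z)"
proof -
  define s where "s = y - z"
  have s: "s = 1 \<or> s = -1" using assms(5) unfolding s_def by linarith
  \<comment> \<open>The first two cases are those where the larger root is not above 2. In
    \<open>id\<close> no index is ever an earlier value; in \<open>shift\<close> every index
    \<open>n \<ge> 2\<close> is.\<close>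
  consider (id) "z = 1" "x = 1" "y = 2" | (shift) "z = 2" "y = 1" "x = 2"
    | (plus) "z \<ge> 2" "y = z + 1" | (minus) "z \<ge> 3" "y = z - 1"
    using assms by fastforce
  then show ?thesis
  proof cases
    case id
    have "hiccup x y z n = int n" if "n \<ge> 1" for n
      using that by (intro hiccup_unique) (auto simp: id)
    then show ?thesis by (intro is_beatty_affine[of _ 0]) simp
  next
    case shift
    have "hiccup x y z n = int n + 1" if "n \<ge> 1" for n
    proof (rule hiccup_unique[OF _ _ that])
      fix n :: nat
      assume "n \<ge> 2"
      then have "int n \<in> (\<lambda>n. int n + 1) ` {1..<n}"
        by (intro image_eqI[of _ _ "n - 1"]) auto
      with \<open>n \<ge> 2\<close> show "int n + 1 = int (n - 1) + 1 +
          (if int n \<in> (\<lambda>n. int n + 1) ` {1..<n} then y else z)"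
        by (simp add: shift)
    qed (simp add: shift)
    then show ?thesis by (rule is_beatty_affine)
  next
    case plus
    define \<alpha> where "\<alpha> = (z + sqrt (z\<^sup>2 + 4)) / 2"
    have "sqrt (z\<^sup>2 + 4) > z" by (rule real_less_rsqrt) simp
    moreover have "sqrt (z\<^sup>2 + 4) < z + 2"
      using plus by (intro real_less_lsqrt) (auto simp: power2_eq_square algebra_simps)
    moreover have "\<alpha>\<^sup>2 = z * \<alpha> + 1"
      by (simp add: \<alpha>_def power_divide power2_sum field_simps) (simp add: power2_eq_square)
    ultimately show ?thesis
      using hiccup_plus_one[of \<alpha> z x] plus assms by (simp add: \<alpha>_def)
  next
    case minus
    define \<alpha> where "\<alpha> = (z + sqrt (z\<^sup>2 - 4)) / 2"
    have z: "real_of_int z \<ge> 3" using minus by simp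
    then have "real_of_int z * z \<ge> 3 * 3" by (intro mult_mono) auto
    then have nonneg: "(real_of_int z)\<^sup>2 - 4 \<ge> 0" by (simp add: power2_eq_square)
    have "sqrt (z\<^sup>2 - 4) > z - 2"
      using z by (intro real_less_rsqrt) (simp add: power2_eq_square algebra_simps)
    moreover have "sqrt (z\<^sup>2 - 4) < z"
      using z by (intro real_less_lsqrt) auto
    ultimately have \<alpha>: "z - 1 < \<alpha>" "\<alpha> < z" by (simp_all add: \<alpha>_def)
    have root: "\<alpha>\<^sup>2 = z * \<alpha> - 1"
      using nonneg by (simp add: \<alpha>_def power_divide power2_sum field_simps) (simp add: power2_eq_square)
    note floor = hiccup_minus_one[OF root \<alpha> \<open>z \<ge> 3\<close>]
    show ?thesis
    proof (cases "x = 1")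
      case False
      have "hiccup x y z n = \<lfloor>\<alpha> * real n + ((x - z) * \<alpha> + 2 * z - 2 - x) / (z - 2)\<rfloor>"
        if "n \<ge> 1" for n
        using floor[of x n] that False assms minus by simp
      then show ?thesis unfolding is_beatty_def by blast
    next
      case True
      \<comment> \<open>The constant for \<open>x = 2\<close> is \<open>2 - \<alpha>\<close>.
        Lowering it by 1 and rounding up keeps every value with a non-integer argument; at
        \<open>n = 1\<close> the argument is exactly 1, which gives the required 1 instead of
        2.\<close>
      have "hiccup x y z n = \<lceil>\<alpha> * real n + (1 - \<alpha>)\<rceil>" if "n \<ge> 1" for n
      proof (cases "n = 1")
        case True
        then show ?thesis using \<open>x = 1\<close> by (simp add: hiccup_1)
      next
        case False
        have "((2 - z) * \<alpha> + 2 * z - 2 - 2) / (z - 2) = 2 - \<alpha>"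
          using z by (simp add: field_simps)
        then have "hiccup x y z n = \<lfloor>\<alpha> * real n + (2 - \<alpha>)\<rfloor>"
          using hiccup_1_eq_hiccup_2[OF that, of z] floor[of 2 n] that False True minus
          by simp
        also have "\<alpha> * real n + (2 - \<alpha>) = \<alpha> * real n + (1 - \<alpha>) + 1" by simp
        also have "\<lfloor>\<dots>\<rfloor> = \<lfloor>\<alpha> * real n + (1 - \<alpha>)\<rfloor> + 1"
          by (rule one_add_floor[symmetric])
        also have "\<dots> = \<lceil>\<alpha> * real n + (1 - \<alpha>)\<rceil>"
        proof -
          have "\<alpha> * real n + (1 - \<alpha>) \<noteq> m" for m :: int
          proof
            assume "\<alpha> * real n + (1 - \<alpha>) = m"
            then have "(int n - 1) * \<alpha> = (m - 1 :: int)" by (simp add: algebra_simps)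
            then show False
              using quadratic_unit_mult_not_int[of \<alpha> z "-1" "int n - 1" "m - 1"]
                root \<alpha> z \<open>n \<ge> 1\<close> \<open>n \<noteq> 1\<close> by simp
          qed
          then show ?thesis by (metis ceiling_altdef)
        qed
        finally show ?thesis .
      qed
      then show ?thesis unfolding is_beatty_def by blast
    qed
  qed
qed

end
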